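(* Let $\mathbf P=(P,x_L,x_R)$ be an oriented poset with vertex weights $w$. The weight matrices corresponding to the source loops $\rhd(\mathbf P\!\searrow)$ and $\rhd(\mathbf P\!\nearrow)$ are given by $$\mathcal M_w\big((\rhd(\mathbf P\!\searrow))\!\searrow\big)=\mathrm{loop}_\searrow\big(\mathcal M_w(\mathbf P\!\searrow)\big),\qquad \mathcal M_w\big((\rhd(\mathbf P\!\nearrow))\!\searrow\big)=\mathrm{loop}_\nearrow\big(\mathcal M_w(\mathbf P\!\nearrow)\big),$$ where $$\mathrm{loop}_\searrow\begin{bmatrix} a & b \\ c & d \end{bmatrix}=\begin{bmatrix} a+d & b-d \\ a+b & 0 \end{bmatrix},\qquad \mathrm{loop}_\nearrow\begin{bmatrix} a & b \\ c & d \end{bmatrix}=\begin{bmatrix} a+d & -a \\ d & 0 \end{bmatrix}.$$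
   Context: An oriented poset $\mathbf P=(P,x_L,x_R)$ is a finite poset $P$ with two specified vertices $x_L$ (left, or target vertex) and $x_R$ (right, or source vertex), possibly equal. Each vertex $i$ of $P$ carries a weight variable $w_i$. An order ideal is a down-closed subset, $J(P)$ is the set of order ideals, and $\mathcal W(P;w)=\sum_{I\in J(P)}\prod_{i\in I}w_i$ is the weight polynomial. A restriction such as $\mathcal W(\mathbf P;w)|_{x_R\in I,\,x_L\notin I}$ means that the sum is only over ideals $I$ satisfying the stated conditions. Down-pointing weight matrix: $$\mathcal M_w(\mathbf P\!\searrow)=\begin{bmatrix}\mathcal W(\mathbf P;w)&-\mathcal W(\mathbf P;w)|_{x_R\in I} \\ \mathcal W(\mathbf P;w)|_{x_L\notin I}&-\mathcal W(\mathbf P;w)|_{x_R\in I,\,x_L\notin I}\end{bmatrix}.$$ Up-pointing weight matrix: $$\mathcal M_w(\mathbf P\!\nearrow)=\begin{bmatrix}\mathcal W(\mathbf P;w)|_{x_R\in I}&\mathcal W(\mathbf P;w)|_{x_R\notin I} \\ \mathcal W(\mathbf P;w)|_{x_R\in I,\,x_L\notin I}&\mathcal W(\mathbf P;w)|_{x_R\notin I,\,x_L\notin I}\end{bmatrix}.$$ $\circlearrowright(\mathbf P\!\searrow)$ denotes the poset obtained from $P$ by adding the relation $x_L\preceq x_R$, and $\circlearrowright(\mathbf P\!\nearrow)$ the poset obtained by adding the relation $x_L\succeq x_R$ (in both cases taking the transitive closure, which is understood to be again a partial order). The source loops are the oriented posets $\rhd(\mathbf P\!\searrow)=(\circlearrowright(\mathbf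 P\!\searrow),x_R,x_R)$ and $\rhd(\mathbf P\!\nearrow)=(\circlearrowright(\mathbf P\!\nearrow),x_R,x_R)$, whose target and source vertices are both $x_R$. *)

theory Defs
  imports "HOL-Analysis.Cartesian_Space"
begin

text \<open>\<open>(x, y) \<in> le P\<close> is read as \<open>x \<preceq> y\<close>.\<close>

record 'a oposet =
  verts :: "'a set"
  le :: "('a \<times> 'a) set"
  left :: 'a
  right :: 'a

definition oriented_poset :: "'a oposet \<Rightarrow> bool" where
  "oriented_poset P \<longleftrightarrow>
     finite (verts P) \<and> partial_order_on (verts P) (le P) \<and> left P \<in> verts P \<and> right P \<in> verts P"

definition order_ideals :: "'a oposet \<Rightarrow> 'a set set" where
  "order_ideals P = {I. I \<subseteq> verts P \<and> (\<forall>x y. y \<in> I \<longrightarrow> (x, y) \<in> le P \<longrightarrow> x \<in> I)}"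

text \<open>The weight polynomial restricted to the ideals satisfying \<open>Q\<close>. The weights range over an
  arbitrary commutative ring; independent variables are the case where \<open>w i\<close> is the
  \<open>i\<close>-th indeterminate of a polynomial ring.\<close>

definition weight_poly_on :: "('a set \<Rightarrow> bool) \<Rightarrow> 'a oposet \<Rightarrow> ('a \<Rightarrow> 'r::comm_ring_1) \<Rightarrow> 'r" where
  "weight_poly_on Q P w = (\<Sum>I | I \<in> order_ideals P \<and> Q I. \<Prod>i\<in>I. w i)"

definition weight_poly :: "'a oposet \<Rightarrow> ('a \<Rightarrow> 'r::comm_ring_1) \<Rightarrow> 'r" where
  "weight_poly P w = (\<Sum>I\<in>order_ideals P. \<Prod>i\<in>I. w i)"

definition mat2 :: "'r \<Rightarrow> 'r \<Rightarrow> 'r \<Rightarrow> 'r \<Rightarrow> 'r::zero^2^2" where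
  "mat2 a b c d = vector [vector [a, b], vector [c, d]]"

definition weight_matrix_down :: "'a oposet \<Rightarrow> ('a \<Rightarrow> 'r::comm_ring_1) \<Rightarrow> 'r^2^2" where
  "weight_matrix_down P w = mat2
     (weight_poly P w)
     (- weight_poly_on (\<lambda>I. right P \<in> I) P w)
     (weight_poly_on (\<lambda>I. left P \<notin> I) P w)
     (- weight_poly_on (\<lambda>I. right P \<in> I \<and> left P \<notin> I) P w)"

definition weight_matrix_up :: "'a oposet \<Rightarrow> ('a \<Rightarrow> 'r::comm_ring_1) \<Rightarrow> 'r^2^2" where
  "weight_matrix_up P w = mat2
     (weight_poly_on (\<lambda>I. right P \<in> I) P w)
     (weight_poly_on (\<lambda>I. right P \<notin> I) P w)
     (weight_poly_on (\<lambda>I. right P \<in> I \<and> left P \<notin> I) P w)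
     (weight_poly_on (\<lambda>I. right P \<notin> I \<and> left P \<notin> I) P w)"

text \<open>The order relations of the posets obtained by adding \<open>left \<preceq> right\<close> (down) and
  \<open>right \<preceq> left\<close> (up). These need not be antisymmetric in general.\<close>

definition circ_down_le :: "'a oposet \<Rightarrow> ('a \<times> 'a) set" where
  "circ_down_le P = (insert (left P, right P) (le P))\<^sup>+"

definition circ_up_le :: "'a oposet \<Rightarrow> ('a \<times> 'a) set" where
  "circ_up_le P = (insert (right P, left P) (le P))\<^sup>+"

definition source_loop_down :: "'a oposet \<Rightarrow> 'a oposet" where
  "source_loop_down P = \<lparr>verts = verts P, le = circ_down_le P, left = right P, right = right P\<rparr>"

definition source_loop_up :: "'a oposet \<Rightarrow> 'a oposet" where
  "source_loop_up P = \<lparr>verts = verts P, le = circ_up_le P, left = right P, right = right P\<rparr>"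

definition loop_down :: "'r::comm_ring_1^2^2 \<Rightarrow> 'r^2^2" where
  "loop_down A = mat2 (A$1$1 + A$2$2) (A$1$2 - A$2$2) (A$1$1 + A$1$2) 0"

definition loop_up :: "'r::comm_ring_1^2^2 \<Rightarrow> 'r^2^2" where
  "loop_up A = mat2 (A$1$1 + A$2$2) (- A$1$1) (A$2$2) 0"

end

(*
  A set closed under a relation is closed under its transitive closure, so adding the relation
  x \<preceq> y keeps exactly those ideals that contain x or avoid y. Each entry of the weight matrix of
  a source loop is therefore a restricted weight polynomial of the original poset, and the
  identities follow by splitting the sums according to membership of the two marked vertices.
*)

theory Submission
  imports Defs
begin

lemma closed_trancl_iff:
  "(\<forall>x y. y \<in> I \<longrightarrow> (x, y) \<in> r\<^sup>+ \<longrightarrow> x \<in> I) \<longleftrightarrow> (\<forall>x y. y \<in> I \<longrightarrow> (x, y) \<in> r \<longrightarrow> x \<in> I)"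
proof safe
  fix x y
  assume r: "\<forall>x y. y \<in> I \<longrightarrow> (x, y) \<in> r \<longrightarrow> x \<in> I" and "(x, y) \<in> r\<^sup>+" "y \<in> I"
  \<comment> \<open>The endpoint \<open>y\<close> moves along the chain while \<open>x\<close> stays
    fixed. Since \<open>y \<in> I\<close> is chained in, it becomes a premise of the induction:
    membership of the new endpoint passes one \<open>r\<close>-step down to the old one, where the
    induction hypothesis applies.\<close>
  from this(2,3) show "x \<in> I"
    by (induction rule: trancl_induct) (use r in blast)+
qed blast

lemma order_ideals_source_loop_down:
  "order_ideals (source_loop_down P) = {I \<in> order_ideals P. right P \<in> I \<longrightarrow> left P \<in> I}"
  unfolding order_ideals_def source_loop_down_def circ_down_le_def
  by (auto simp: closed_trancl_iff)

lemma order_ideals_source_loop_up: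
  "order_ideals (source_loop_up P) = {I \<in> order_ideals P. left P \<in> I \<longrightarrow> right P \<in> I}"
  unfolding order_ideals_def source_loop_up_def circ_up_le_def
  by (auto simp: closed_trancl_iff)

lemma finite_order_ideals: "finite (verts P) \<Longrightarrow> finite (order_ideals P)"
  by (rule finite_subset[of _ "Pow (verts P)"]) (auto simp: order_ideals_def)

text \<open>Brings the unrestricted entry into the form of the others, so that splitting and passage
  to the loop apply to it too.\<close>

lemma weight_poly_eq_on: "weight_poly P w = weight_poly_on (\<lambda>I. True) P w"
  by (simp add: weight_poly_def weight_poly_on_def)

text \<open>Finiteness makes the sum additive over the two disjoint families; a sum over an infinite
  set would be 0 by convention.\<close>

lemma weight_poly_on_split:
  assumes "finite (verts P)" and "\<And>I. Q I \<longleftrightarrow> Q1 I \<or> Q2 I" and "\<And>I. \<not> (Q1 I \<and> Q2 I)"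
  shows "weight_poly_on Q P w = weight_poly_on Q1 P w + weight_poly_on Q2 P w"
proof -
  have "{I \<in> order_ideals P. Q I} = {I \<in> order_ideals P. Q1 I} \<union> {I \<in> order_ideals P. Q2 I}"
    using assms(2) by blast
  then show ?thesis
    unfolding weight_poly_on_def
    using assms(3) finite_order_ideals[OF assms(1)] by (simp add: sum.union_disjoint disjoint_iff)
qed

lemma weight_poly_on_source_loop_down:
  "weight_poly_on Q (source_loop_down P) w =
     weight_poly_on (\<lambda>I. (right P \<in> I \<longrightarrow> left P \<in> I) \<and> Q I) P w"
  by (simp add: weight_poly_on_def order_ideals_source_loop_down conj_assoc)

lemma weight_poly_on_source_loop_up:
  "weight_poly_on Q (source_loop_up P) w =
     weight_poly_on (\<lambda>I. (left P \<in> I \<longrightarrow> right P \<in> I) \<and> Q I) P w"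
  by (simp add: weight_poly_on_def order_ideals_source_loop_up conj_assoc)

lemma mat2_nth [simp]:
  "mat2 a b c d $ 1 $ 1 = a" "mat2 a b c d $ 1 $ 2 = b"
  "mat2 a b c d $ 2 $ 1 = c" "mat2 a b c d $ 2 $ 2 = d"
  by (simp_all add: mat2_def)

lemma mat2_cong:
  "a = a' \<Longrightarrow> b = b' \<Longrightarrow> c = c' \<Longrightarrow> d = d' \<Longrightarrow> mat2 a b c d = mat2 a' b' c' d'"
  by simp

text \<open>Source of the zero in the lower right corner: both marked vertices of a source loop
  coincide, so that entry asks for ideals that contain and avoid the same vertex.\<close>

lemma weight_poly_on_False [simp]: "weight_poly_on (\<lambda>I. False) P w = 0"
  by (simp add: weight_poly_on_def)

lemma weight_matrix_source_loop_down:
  assumes "finite (verts P)"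
  shows "weight_matrix_down (source_loop_down P) w = loop_down (weight_matrix_down P w)"
proof -
  let ?l = "left P" and ?r = "right P"
  let ?W = "\<lambda>Q. weight_poly_on Q P w"
  have [simp]: "left (source_loop_down P) = ?r" "right (source_loop_down P) = ?r"
    by (simp_all add: source_loop_down_def)
  note split = weight_poly_on_split[OF assms]
  \<comment> \<open>Write a, b, c, d for the entries of the matrix of \<open>P\<close>. Ideals lost
    by adding the relation contain \<open>?r\<close> but not \<open>?l\<close> and have total weight
    -d. So 1 yields the entry a + d and 2 the entry b - d. Ideals avoiding \<open>?r\<close> all
    survive, so 3 yields a + b.\<close>
  have 1: "?W (\<lambda>I. True) = ?W (\<lambda>I. ?r \<in> I \<longrightarrow> ?l \<in> I) + ?W (\<lambda>I. ?r \<in> I \<and> ?l \<notin> I)"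
    by (rule split) auto
  have 2: "?W (\<lambda>I. ?r \<in> I) =
      ?W (\<lambda>I. (?r \<in> I \<longrightarrow> ?l \<in> I) \<and> ?r \<in> I) + ?W (\<lambda>I. ?r \<in> I \<and> ?l \<notin> I)"
    by (rule split) auto
  have 3: "?W (\<lambda>I. True) = ?W (\<lambda>I. (?r \<in> I \<longrightarrow> ?l \<in> I) \<and> ?r \<notin> I) + ?W (\<lambda>I. ?r \<in> I)"
    by (rule split) auto
  show ?thesis
    unfolding weight_matrix_down_def loop_down_def weight_poly_eq_on
      weight_poly_on_source_loop_down mat2_nth
    by (rule mat2_cong) (use 1 2 3 in \<open>simp_all add: algebra_simps\<close>)
qed

lemma weight_matrix_source_loop_up:
  assumes "finite (verts P)"
  shows "weight_matrix_down (source_loop_up P) w = loop_up (weight_matrix_up P w)"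
proof -
  let ?l = "left P" and ?r = "right P"
  let ?W = "\<lambda>Q. weight_poly_on Q P w"
  have [simp]: "left (source_loop_up P) = ?r" "right (source_loop_up P) = ?r"
    by (simp_all add: source_loop_up_def)
  \<comment> \<open>A surviving ideal either contains \<open>?r\<close>, which makes the new
    condition automatic, or avoids both vertices. These two classes have the weights a and d of the
    up-pointing matrix.\<close>
  have 1: "?W (\<lambda>I. ?l \<in> I \<longrightarrow> ?r \<in> I) = ?W (\<lambda>I. ?r \<in> I) + ?W (\<lambda>I. ?r \<notin> I \<and> ?l \<notin> I)"
    by (rule weight_poly_on_split[OF assms]) auto
  have 2: "(\<lambda>I. (?l \<in> I \<longrightarrow> ?r \<in> I) \<and> ?r \<in> I) = (\<lambda>I. ?r \<in> I)"
    and 3: "(\<lambda>I. (?l \<in> I \<longrightarrow> ?r \<in> I) \<and> ?r \<notin> I) = (\<lambda>I. ?r \<notin> I \<and> ?l \<notin> I)"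
    by auto
  show ?thesis
    unfolding weight_matrix_down_def weight_matrix_up_def loop_up_def weight_poly_eq_on
      weight_poly_on_source_loop_up mat2_nth
    by (simp add: 1 2 3)
qed

theorem theorem5p5:
  fixes P :: "'a oposet" and w :: "'a \<Rightarrow> 'r::comm_ring_1"
  assumes "oriented_poset P"
  shows "(partial_order_on (verts P) (circ_down_le P) \<longrightarrow>
            weight_matrix_down (source_loop_down P) w = loop_down (weight_matrix_down P w)) \<and>
         (partial_order_on (verts P) (circ_up_le P) \<longrightarrow>
            weight_matrix_down (source_loop_up P) w = loop_up (weight_matrix_up P w))"
  using assms weight_matrix_source_loop_down weight_matrix_source_loop_up
  unfolding oriented_poset_def by blast

end
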